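(* Let $\mathcal{C}$ be a set, let $\mathrm{safe}:\mathcal{C}\to\mathcal{M}$ be a function into the set $\mathcal M$ of conditional generative models, and write $\mathrm{safe}_C=\mathrm{safe}(C)$. Let $x\in\mathcal{X}$ be a prompt and suppose the model $p\in\mathcal M$ is $k_x$-near access-free on prompt $x$ with respect to $\mathcal{C}$, $\mathrm{safe}$ and $\Delta=\Delta_{\max}$. Then for every $C\in\mathcal{C}$ and every event $\mathcal{E}\subseteq\mathcal{Y}$, \[ p(\mathcal{E}|x)\;\le\;2^{k_x}\cdot \mathrm{safe}_C(\mathcal{E}|x). \]
   Context: $\mathcal X$ is a set of prompts and $\mathcal Y$ a discrete (countable) set of outputs. A conditional generative model $p\in\mathcal M$ assigns to each $x\in\mathcal X$ a probability mass function $p(\cdot|x)$ on $\mathcal Y$; for $\mathcal E\subseteq\mathcal Y$, $p(\mathcal E|x)=\sum_{y\in\mathcal E}p(y|x)$. All logarithms are base 2. For distributions $\rho,\mu$ on $\mathcal Y$, $\Delta_{\max}(\rho\|\mu)=\max_{y\in\mathrm{Supp}(\rho)}\log\frac{\rho(y)}{\mu(y)}$ (a supremum if the support is infinite; the ratio is $+\infty$ if $\mu(y)=0<\rho(y)$). Given a set $\mathcal C$, a function $\mathrm{safe}:\mathcal C\to\mathcal M$ and a divergence $\Delta$, a model $p$ is $k_x$-near access-free ($k_x$-NAF) on prompt $x$ with respect to $\mathcal C$, $\mathrm{safe}$, $\Delta$ if $\Delta\bigl(p(\cdot|x)\,\|\,\mathrm{safe}_C(\cdot|x)\bigr)\le k_x$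 for every $C\in\mathcal C$. *)

theory Defs
  imports "HOL-Probability.Probability_Mass_Function"
begin

type_synonym ('x, 'y) cond_model = "'x \<Rightarrow> 'y pmf"

definition event_prob :: "('x, 'y::countable) cond_model \<Rightarrow> 'y set \<Rightarrow> 'x \<Rightarrow> real" where
  "event_prob p E x = (\<Sum>\<^sub>\<infinity>y\<in>E. pmf (p x) y)"

(* The infinite sum always converges, so the default value 0 of infsum never intervenes. *)
lemma event_prob_eq_prob: "event_prob p E x = measure_pmf.prob (p x) E"
proof -
  have "event_prob p E x = infsetsum (pmf (p x)) E"
    unfolding event_prob_def by (rule infsetsum_infsum[symmetric]) (rule pmf_abs_summable)
  then show ?thesis by (simp add: measure_pmf_conv_infsetsum)
qed

(* Only used for a > 0. The value for b = 0 is explicit because HOL sets a / 0 = 0. *)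
definition log2_ratio :: "real \<Rightarrow> real \<Rightarrow> ereal" where
  "log2_ratio a b = (if b = 0 then \<infinity> else ereal (log 2 (a / b)))"

definition Delta_max :: "'y::countable pmf \<Rightarrow> 'y pmf \<Rightarrow> ereal" where
  "Delta_max \<rho> \<mu> = (SUP y\<in>set_pmf \<rho>. log2_ratio (pmf \<rho> y) (pmf \<mu> y))"

(* Only the values of safe on the index set CC matter. *)
definition near_access_free ::
  "'c set \<Rightarrow> ('c \<Rightarrow> ('x, 'y::countable) cond_model) \<Rightarrow> ('y pmf \<Rightarrow> 'y pmf \<Rightarrow> ereal)
    \<Rightarrow> real \<Rightarrow> 'x \<Rightarrow> ('x, 'y) cond_model \<Rightarrow> bool" where
  "near_access_free CC safe \<Delta> k x p \<longleftrightarrow> (\<forall>C\<in>CC. \<Delta> (p x) (safe C x) \<le> ereal k)"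

end

theory Submission
  imports Defs
begin

text \<open>A finite bound on the max-divergence is a pointwise domination of mass functions:
  exponentiating the log ratio gives \<open>Delta_max_le_imp_pmf_le\<close>. Summing this over the
  event and pulling out the constant factor yields the bound on probabilities.\<close>

lemma pmf_summable_on: "pmf p summable_on A"
  using abs_summable_equivalent pmf_abs_summable abs_summable_summable by blast

text \<open>The supremum controls only outcomes in the support of \<open>\<rho>\<close>; elsewhere
  the left side is 0. Hence \<open>y\<close> is arbitrary, as summation over any event
  requires.\<close>

lemma Delta_max_le_imp_pmf_le:
  assumes "Delta_max \<rho> \<mu> \<le> ereal k"
  shows "pmf \<rho> y \<le> 2 powr k * pmf \<mu> y"
proof (cases "y \<in> set_pmf \<rho>")
  case True
  then have "log2_ratio (pmf \<rho> y) (pmf \<mu> y) \<le> ereal k"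
    using assms unfolding Delta_max_def by (meson SUP_le_iff)
  \<comment> \<open>A zero denominator would make \<open>log2_ratio\<close> infinite, contradicting
    the real bound \<open>k\<close>.\<close>
  then have nz: "pmf \<mu> y \<noteq> 0" and le: "log 2 (pmf \<rho> y / pmf \<mu> y) \<le> k"
    by (auto simp: log2_ratio_def split: if_splits)
  have pos: "pmf \<mu> y > 0" "pmf \<rho> y > 0"
    using nz True by (simp_all add: order.strict_iff_not pmf_le_0_iff set_pmf_iff)
  then have "pmf \<rho> y / pmf \<mu> y \<le> 2 powr k"
    using le by (simp add: log_le_iff)
  with pos show ?thesis by (simp add: field_simps)
next
  case False
  then show ?thesis by (simp add: set_pmf_iff)
qed

theorem lemma2p2:
  fixes CC :: "'c set"
    and safe :: "'c \<Rightarrow> ('x, 'y::countable) cond_model"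
    and p :: "('x, 'y) cond_model"
    and x :: 'x
    and k\<^sub>x :: real
  assumes "near_access_free CC safe Delta_max k\<^sub>x x p"
  shows "\<forall>C\<in>CC. \<forall>E :: 'y set.
    event_prob p E x \<le> 2 powr k\<^sub>x * event_prob (safe C) E x"
proof (intro ballI allI)
  fix C and E :: "'y set"
  assume "C \<in> CC"
  then have "Delta_max (p x) (safe C x) \<le> ereal k\<^sub>x"
    using assms by (simp add: near_access_free_def)
  \<comment> \<open>Monotonicity of \<open>infsum\<close> needs both families summable, since a
    divergent sum would default to 0.\<close>
  then have "(\<Sum>\<^sub>\<infinity>y\<in>E. pmf (p x) y) \<le> (\<Sum>\<^sub>\<infinity>y\<in>E. 2 powr k\<^sub>x * pmf (safe C x) y)"
    by (intro infsum_mono summable_on_cmult_right pmf_summable_on Delta_max_le_imp_pmf_le)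
  then show "event_prob p E x \<le> 2 powr k\<^sub>x * event_prob (safe C) E x"
    by (simp add: event_prob_def infsum_cmult_right pmf_summable_on)
qed

end
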